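(* Let $\mathbb{F}_q$ be a finite field, let $n \geq 1$ and $s \geq 1$ be integers, let $d_1,\ldots,d_s \in \mathbb{Z}$, and let $\rho_1,\ldots,\rho_s$ be distinct elements of an algebraically closed field containing $\mathbb{F}_q$ such that $u(x)=\prod_{i=1}^{s}(x-\rho_i)^{d_i}$ belongs to $\mathbb{F}_q(x)$. Suppose that the equation $$y^{n}=\prod_{i=1}^{s}(x-\rho_{i})^{d_{i}}$$ is an affine model of an irreducible plane curve $C$ over $\mathbb{F}_q$ (that is, $Y^n-u(x)$ is irreducible in $\mathbb{F}_q(x)[Y]$), with function field $\mathbb{F}_q(x,y)$, and that the field extension $\mathbb{F}_q(x)\hookrightarrow \mathbb{F}_q(x,y)$ is Galois. Then the covering $C\rightarrow \mathbb{P}^1$ over $\mathbb{F}_q$ corresponding to this extension is a cyclic covering of $\mathbb{P}^1$, and the automorphism group $\mathrm{Aut}(C)$ contains a cyclic subgroup isomorphic to $\mathbb{Z}_n$.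
   Context: Here $\mathbb{F}_q$ is a finite field with $q$ elements, $q$ a power of a prime $p$, and $\mathbb{F}_q(x)$ is the rational function field, i.e. the function field of the projective line $\mathbb{P}^1$ over $\mathbb{F}_q$. The group $\mathbb{Z}_n$ is the cyclic group of order $n$. The curve $C$ is identified with the non-singular projective curve over $\mathbb{F}_q$ with function field $\mathbb{F}_q(x,y)$, and $\mathrm{Aut}(C)$ is the group of automorphisms of this curve over $\mathbb{F}_q$, equivalently the group of field automorphisms of $\mathbb{F}_q(x,y)$ fixing $\mathbb{F}_q$. The inclusion $\mathbb{F}_q(x)\hookrightarrow\mathbb{F}_q(x,y)$ corresponds to the morphism $C\to\mathbb{P}^1$ given by the function $x$. This morphism is called a cyclic covering of $\mathbb{P}^1$ if the extension $\mathbb{F}_q(x)\hookrightarrow \mathbb{F}_q(x,y)$ is Galois with cyclic Galois group; the quotient of $C$ by this group is then the projective line. *)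

theory Defs
  imports
    "HOL-Algebra.Algebraic_Closure_Type"
    "HOL-Algebra.Generated_Fields"
    "HOL-Algebra.Elementary_Groups"
    "HOL-Algebra.Bij"
begin

text \<open>
  The coefficient fields are types, made into ring records by
  \<^const>\<open>ring_of_type_algebra\<close>; the rational function field over the field type
  \<open>'a\<close> is the type \<open>'a poly fract\<close>.  Their extension fields are ring records,
  because their automorphism groups are treated as groups.
\<close>

definition const_ratfun :: "'a::field \<Rightarrow> 'a poly fract"
  where "const_ratfun c = Fraction_Field.Fract [:c:] 1"

definition linear_ratfun :: "'a::field \<Rightarrow> 'a poly fract"
  where "linear_ratfun c = Fraction_Field.Fract [:- c, 1:] 1"

text \<open>
  The group of automorphisms of the field \<open>L\<close> that fix the set \<open>K\<close> pointwise.
  As for \<^const>\<open>AutoGroup\<close>, automorphisms are extensional functions, so that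
  each one is counted once.
\<close>

definition field_aut :: "('l, 'm) ring_scheme \<Rightarrow> 'l set \<Rightarrow> ('l \<Rightarrow> 'l) set"
  where "field_aut L K = {\<sigma> \<in> ring_hom L L \<inter> Bij (carrier L). \<forall>a\<in>K. \<sigma> a = a}"

definition field_aut_group :: "('l, 'm) ring_scheme \<Rightarrow> 'l set \<Rightarrow> ('l \<Rightarrow> 'l) monoid"
  where "field_aut_group L K = BijGroup (carrier L) \<lparr>carrier := field_aut L K\<rparr>"

text \<open>
  Galois means algebraic, normal and separable: the minimal polynomial over \<open>K\<close>
  of every element of \<open>L\<close> splits into linear factors over \<open>L\<close>, and these are distinct.
  Since all roots lie in \<open>L\<close>, separability can be tested there.
\<close>

definition (in ring) galois_over :: "'a set \<Rightarrow> bool"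
  where "galois_over K \<longleftrightarrow> subfield K R \<and>
    (\<forall>a\<in>carrier R. (algebraic over K) a \<and>
       splitted (Irr K a) \<and>
       (\<forall>b\<in>carrier R. alg_mult (Irr K a) b \<le> 1))"

abbreviation galois_extension :: "('l, 'm) ring_scheme \<Rightarrow> 'l set \<Rightarrow> bool"
  where "galois_extension L K \<equiv> ring.galois_over L K"

definition cyclic_galois_extension :: "('l, 'm) ring_scheme \<Rightarrow> 'l set \<Rightarrow> bool"
  where "cyclic_galois_extension L K \<longleftrightarrow>
    galois_extension L K \<and> cyclic_group (field_aut_group L K)"

lemma (in field) group_field_aut_group:
  assumes K: "K \<subseteq> carrier R"
  shows "group (field_aut_group R K)"
proof -
  have "subgroup (field_aut R K) (BijGroup (carrier R))"
  proof (rule group.subgroupI[OF group_BijGroup])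
    show "field_aut R K \<subseteq> carrier (BijGroup (carrier R))"
      by (auto simp: field_aut_def BijGroup_def)
    have "(\<lambda>x\<in>carrier R. x) \<in> field_aut R K"
      using K by (auto simp: field_aut_def id_Bij intro!: ring_hom_memI)
    then show "field_aut R K \<noteq> {}" by blast
  next
    fix s assume s: "s \<in> field_aut R K"
    then have h: "s \<in> ring_hom R R" and B: "s \<in> Bij (carrier R)" and fx: "\<And>a. a \<in> K \<Longrightarrow> s a = a"
      by (auto simp: field_aut_def)
    have bij: "bij_betw s (carrier R) (carrier R)" using B by (simp add: Bij_def)
    let ?t = "\<lambda>x\<in>carrier R. inv_into (carrier R) s x"
    have tc: "inv_into (carrier R) s x \<in> carrier R" if "x \<in> carrier R" for x
      using B that by (rule Bij_inv_into_mem)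
    have st: "s (inv_into (carrier R) s x) = x" if "x \<in> carrier R" for x
      using bij that by (meson bij_betw_inv_into_right)
    have ts: "inv_into (carrier R) s (s x) = x" if "x \<in> carrier R" for x
      using bij that by (meson bij_betw_inv_into_left)
    have eqI: "x = z" if "s x = s z" "x \<in> carrier R" "z \<in> carrier R" for x z
      using ts that by metis
    have "?t \<in> ring_hom R R"
    proof (rule ring_hom_memI)
      fix x z assume xz: "x \<in> carrier R" "z \<in> carrier R"
      show "?t x \<in> carrier R" using tc xz by simp
      show "?t (x \<otimes> z) = ?t x \<otimes> ?t z" 
        using xz tc st by - (rule eqI, simp_all add: ring_hom_mult[OF h])
      show "?t (x \<oplus> z) = ?t x \<oplus> ?t z"
        using xz tc st by - (rule eqI, simp_all add: ring_hom_add[OF h])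
    next
      show "?t \<one> = \<one>" using tc st by - (rule eqI, simp_all add: ring_hom_one[OF h])
    qed
    moreover have "?t a = a" if "a \<in> K" for a
      using ts[of a] fx[OF that] that K by auto
    ultimately have "?t \<in> field_aut R K"
      using restrict_inv_into_Bij[OF B] by (auto simp: field_aut_def)
    then show "inv\<^bsub>BijGroup (carrier R)\<^esub> s \<in> field_aut R K"
      by (simp add: inv_BijGroup[OF B])
  next
    fix s t assume s: "s \<in> field_aut R K" and t: "t \<in> field_aut R K"
    have "compose (carrier R) s t \<in> ring_hom R R"
      using s t by (auto simp: field_aut_def compose_def ring_hom_def Pi_iff)
    moreover have "compose (carrier R) s t \<in> Bij (carrier R)"
      using s t by (auto simp: field_aut_def intro: compose_Bij)
    moreover have "compose (carrier R) s t a = a" if "a \<in> K" for a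
      using s t that K by (auto simp: field_aut_def compose_def)
    ultimately show "s \<otimes>\<^bsub>BijGroup (carrier R)\<^esub> t \<in> field_aut R K"
      using s t by (auto simp: field_aut_def BijGroup_def)
  qed
  then show ?thesis
    unfolding field_aut_group_def
    by (rule subgroup.subgroup_is_group[OF _ group_BijGroup])
qed

end

theory Submission
  imports Defs
begin

text \<open>
  The extension is Galois and the polynomial $Y^n - u$ is irreducible with a root in \<open>L\<close>, so it
  has \<open>n\<close> distinct roots there (\<open>galois_imp_distinct_roots\<close>); their quotients by \<open>y\<close> are \<open>n\<close> distinct
  \<open>n\<close>-th roots of unity of \<open>L\<close>.  Consequently the characteristic \<open>p\<close> does not divide \<open>n\<close>: otherwise
  $X^n - 1 = (X^{n/p} - 1)^p$ would have at most $n/p$ roots.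

  The heart of the matter is that these roots of unity lie in the constant field.  This fails for
  general \<open>u\<close>, because \<open>L\<close> may contain an extension of the constants, and then the Galois group need
  not be abelian: if $q \<equiv> 2$ modulo \<open>3\<close> is odd and \<open>c\<close> is not a square, then $Y^6 = c x^2$ defines
  a Galois extension whose group is the symmetric group on three letters.  Here \<open>u\<close> is a product
  of integer powers of monic linear factors, so as a quotient of polynomials it has numerator and
  denominator with equal leading coefficients.  After the substitution $x = t^{-n}$
  it becomes $t^{nk}$ times a power series with constant term \<open>1\<close>, and such a
  series has an \<open>n\<close>-th root because \<open>n\<close> is invertible.  So \<open>u\<close> is an \<open>n\<close>-th power in the field of
  Laurent series in \<open>t\<close> over the constant field, and sending \<open>y\<close> to its root embeds \<open>L\<close> into that
  field: in geometric terms, the curve has a rational place over \<open>\<infinity>\<close>.  The only \<open>n\<close>-th roots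
  of unity among the Laurent series are constants, hence the same holds in \<open>L\<close>
  (\<open>roots_of_unity_are_constants\<close>).

  What remains is Kummer theory.  The constant field has \<open>n\<close> roots of unity of order dividing \<open>n\<close>, and
  they are the powers of one \<open>\<zeta>\<close>.  Every power gives an automorphism of \<open>L\<close> over the rational
  function field with \<open>y \<mapsto> \<zeta>\<^sup>k y\<close>, and there are no others, as an automorphism permutes the roots of
  $Y^n - u$ and is determined by the image of \<open>y\<close>.  Composition of automorphisms adds the exponents
  modulo \<open>n\<close> (\<open>kummer_galois_group\<close>).  The Galois group is thus cyclic of order \<open>n\<close>, and it is a
  subgroup of the group of all automorphisms over the constants.
\<close>

section \<open>Roots in power series and Laurent series\<close>

text \<open>
  The series $(1+X)^n - 1$ starts with $nX$, so it is invertible under composition as soon as \<open>n\<close> is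
  invertible.  One plus its compositional inverse is an \<open>n\<close>-th root of $1+X$, into which $z - 1$ can
  be substituted.  This works in every characteristic, whereas the usual formula for the
  coefficients of the binomial series divides by factorials.
\<close>
lemma fps_nth_root_exists:
  fixes z :: "'a::field fps"
  assumes "fps_nth z 0 = 1" and n: "of_nat n \<noteq> (0::'a)"
  shows "\<exists>w. w ^ n = z"
proof -
  define a where "a = (1 + fps_X) ^ n - (1 :: 'a fps)"
  have a0: "fps_nth a 0 = 0"
    by (simp add: a_def fps_power_zeroth)
  have "fps_nth ((1 + fps_X) ^ m :: 'a fps) 1 = of_nat m" for m
    by (induction m) (simp_all add: algebra_simps fps_power_zeroth)
  then have a1: "fps_nth a 1 \<noteq> 0"
    using n by (simp add: a_def)
  have z0: "fps_nth (z - 1) 0 = 0"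
    using assms(1) by simp
  have "(1 + fps_inv a) ^ n = 1 + fps_X"
  proof -
    have i0: "fps_nth (fps_inv a) 0 = 0" by (simp add: fps_inv_def)
    have "((1 + fps_X) ^ n - 1) oo fps_inv a = (1 + fps_inv a) ^ n - 1"
      by (simp add: fps_compose_sub_distrib fps_compose_power[OF i0, symmetric] fps_compose_add_distrib i0)
    then have "a oo fps_inv a = (1 + fps_inv a) ^ n - 1"
      by (simp only: a_def)
    with fps_inv_right[OF a0 a1] show ?thesis
      by (metis add.commute diff_add_cancel)
  qed
  then have "((1 + fps_inv a) oo (z - 1)) ^ n = (1 + fps_X) oo (z - 1)"
    by (simp only: fps_compose_power[OF z0])
  also have "\<dots> = z"
    using z0 by (simp add: fps_compose_add_distrib)
  finally show ?thesis ..
qed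

text \<open>
  A root of unity has order zero at \<open>t = 0\<close>, so it is a power series \<open>v\<close> with constant term \<open>a\<close>, and
  \<open>a\<close> is a root of unity, too.  In $0 = v^n - a^n = (v - a) s$ the cofactor \<open>s\<close> has the
  constant term $n a^{n-1} \<noteq> 0$, which forces $v = a$.
\<close>
lemma fls_root_of_unity_is_const:
  fixes w :: "'a::field fls"
  assumes w: "w ^ n = 1" and n: "of_nat n \<noteq> (0::'a)"
  shows "\<exists>c. w = fls_const c"
proof -
  have "n > 0" using n by (cases n) auto
  have "w \<noteq> 0" using w \<open>n > 0\<close> by (auto simp: power_0_left)
  have "int n * fls_subdegree w = fls_subdegree (w ^ n)"
    by (simp add: fls_subdegree_pow)
  then have "fls_subdegree w = 0"
    using \<open>n > 0\<close> by (simp add: w)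
  then obtain v where v: "w = fps_to_fls v"
    using fls_as_fps[of w 0] by auto
  have v0: "fps_nth v 0 \<noteq> 0"
    using \<open>fls_subdegree w = 0\<close> \<open>w \<noteq> 0\<close> nth_fls_subdegree_nonzero[of w] by (simp add: v)
  have "fps_to_fls (v ^ n) = fps_to_fls 1"
    using w by (simp add: v fps_to_fls_power)
  then have vn: "v ^ n = 1"
    by (simp del: fps_to_fls_power)
  define a where "a = fps_const (fps_nth v 0)"
  have "fps_nth v 0 ^ n = 1"
    using arg_cong[OF vn, of "\<lambda>f. fps_nth f 0"] by (simp add: fps_power_zeroth)
  then have "a ^ n = 1"
    by (simp add: a_def)
  define s where "s = (\<Sum>i<n. a ^ (n - Suc i) * v ^ i)"
  have "0 = (v - a) * s"
    using power_diff_sumr2[of v n a]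
    by (simp add: s_def \<open>a ^ n = 1\<close> vn)
  moreover have "s \<noteq> 0"
  proof -
    have "fps_nth s 0 = (\<Sum>i<n. fps_nth v 0 ^ (n - Suc i) * fps_nth v 0 ^ i)"
      by (simp add: s_def a_def fps_sum_nth fps_power_zeroth)
    also have "\<dots> = (\<Sum>i<n. fps_nth v 0 ^ (n - 1))"
      by (intro sum.cong refl) (auto simp flip: power_add)
    finally have "fps_nth s 0 = of_nat n * fps_nth v 0 ^ (n - 1)" by simp
    then show ?thesis using n v0 by auto
  qed
  ultimately have "v = a" by simp
  then have "w = fls_const (fps_nth v 0)"
    by (metis v a_def fps_const_to_fls)
  then show ?thesis ..
qed


section \<open>Rational functions\<close>

lemma const_ratfun_inj: "const_ratfun a = const_ratfun b \<Longrightarrow> a = b"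
  by (simp add: const_ratfun_def eq_fract)

lemma const_ratfun_one: "const_ratfun 1 = 1"
  by (simp add: const_ratfun_def One_fract_def one_pCons)

lemma const_ratfun_mult: "const_ratfun (a * b) = const_ratfun a * const_ratfun b"
  by (simp add: const_ratfun_def mult.commute)

lemma const_ratfun_power: "const_ratfun (a ^ m) = const_ratfun a ^ m"
  by (induction m) (simp_all add: const_ratfun_one const_ratfun_mult)

lemma of_nat_eq_const_ratfun: "of_nat m = const_ratfun (of_nat m :: 'a::field)"
  by (induction m) (simp_all add: const_ratfun_def Zero_fract_def One_fract_def one_pCons add.commute)

text \<open>
  The universal property of the field of fractions, for an injective homomorphism into a field.
\<close>
lemma fraction_field_hom_exists:
  fixes \<phi> :: "'p::idom \<Rightarrow> 'f::field"
  assumes add: "\<And>a b. \<phi> (a + b) = \<phi> a + \<phi> b"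
    and mult: "\<And>a b. \<phi> (a * b) = \<phi> a * \<phi> b"
    and one: "\<phi> 1 = 1"
    and nz: "\<And>a. a \<noteq> 0 \<Longrightarrow> \<phi> a \<noteq> 0"
  shows "\<exists>h \<in> ring_hom ring_of_type_algebra ring_of_type_algebra.
    \<forall>a b. b \<noteq> 0 \<longrightarrow> h (Fraction_Field.Fract a b) = \<phi> a / \<phi> b"
proof -
  have "\<exists>r. \<forall>a b. b \<noteq> 0 \<longrightarrow> q = Fraction_Field.Fract a b \<longrightarrow> r = \<phi> a / \<phi> b" for q
  proof -
    obtain a b where ab: "q = Fraction_Field.Fract a b" "b \<noteq> 0"
      by (cases q) auto
    have "\<phi> a / \<phi> b = \<phi> a' / \<phi> b'" if "b' \<noteq> 0" "q = Fraction_Field.Fract a' b'" for a' b'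
    proof -
      have "a * b' = a' * b" using that ab by (simp add: eq_fract)
      then have "\<phi> a * \<phi> b' = \<phi> a' * \<phi> b" by (metis mult)
      then show ?thesis using nz ab that by (simp add: frac_eq_eq)
    qed
    then show ?thesis by blast
  qed
  then obtain h where h: "\<And>q a b. b \<noteq> 0 \<Longrightarrow> q = Fraction_Field.Fract a b \<Longrightarrow> h q = \<phi> a / \<phi> b"
    by metis
  have "h (p + q) = h p + h q \<and> h (p * q) = h p * h q" for p q
  proof -
    obtain a b c d where "p = Fraction_Field.Fract a b" "b \<noteq> 0" "q = Fraction_Field.Fract c d" "d \<noteq> 0"
      by (cases p, cases q) auto
    then show ?thesis
      using nz by (simp add: h[OF _ refl] add mult add_frac_eq)
  qed
  moreover have "h 1 = 1"
    using h[of 1 1 1] by (simp add: One_fract_def one)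
  ultimately have "h \<in> ring_hom ring_of_type_algebra ring_of_type_algebra"
    by (auto simp: ring_of_type_algebra_def intro!: ring_hom_memI)
  then show ?thesis using h by blast
qed

text \<open>
  This is all that the rest of the proof uses of the factorization of \<open>u\<close>.  The product is a
  quotient of monic polynomials over the big field, and the embedding \<open>\<iota>\<close> of the coefficient
  fields is injective and carries leading coefficients to leading coefficients.
\<close>
lemma lead_coeffs_of_monic_product:
  fixes \<iota> :: "'a::field \<Rightarrow> 'b::field"
  assumes \<iota>: "\<iota> \<in> ring_hom ring_of_type_algebra ring_of_type_algebra"
    and g: "g \<noteq> 0"
    and eq: "Fraction_Field.Fract (map_poly \<iota> f) (map_poly \<iota> g) =
         (\<Prod>i\<in>I. linear_ratfun (\<rho> i) powi d i)"
  shows "Polynomial.lead_coeff f = Polynomial.lead_coeff g"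
proof -
  have \<iota>_mult: "\<iota> (a * b) = \<iota> a * \<iota> b" and \<iota>_add: "\<iota> (a + b) = \<iota> a + \<iota> b" and \<iota>_one: "\<iota> 1 = 1" for a b
    using \<iota> by (auto simp: ring_of_type_algebra_def ring_hom_def)
  have \<iota>_0: "\<iota> 0 = 0" using \<iota>_add[of 0 0] by (metis add_cancel_right_right)
  have \<iota>_nz: "\<iota> a \<noteq> 0" if "a \<noteq> 0" for a
    using that \<iota>_mult[of a "inverse a"] \<iota>_one by auto
  have \<iota>_inj: "a = b" if "\<iota> a = \<iota> b" for a b
    using \<iota>_add[of "a - b" b] \<iota>_nz[of "a - b"] that by auto
  have monic_frac: "\<exists>A B. q = Fraction_Field.Fract A B \<and> Polynomial.lead_coeff A = 1 \<and> Polynomial.lead_coeff B = 1"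
    if "q = linear_ratfun c powi k" for q and c :: 'b and k
  proof -
    have pw: "Fraction_Field.Fract A B ^ m = Fraction_Field.Fract (A ^ m) (B ^ m)" for A B :: "'b poly" and m
      by (induction m) (simp_all add: One_fract_def)
    show ?thesis
    proof (cases "k \<ge> 0")
      case True
      then show ?thesis using that
        by (intro exI[of _ "[:- c, 1:] ^ nat k"] exI[of _ 1])
          (simp add: linear_ratfun_def power_int_def pw lead_coeff_power)
    next
      case False
      then show ?thesis using that
        by - (rule exI[of _ 1], rule exI[of _ "[:- c, 1:] ^ nat (- k)"],
          simp add: linear_ratfun_def power_int_def pw lead_coeff_power power_inverse[symmetric])
    qed
  qed
  have "\<exists>A B. (\<Prod>i\<in>I. linear_ratfun (\<rho> i) powi d i) = Fraction_Field.Fract A B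
       \<and> Polynomial.lead_coeff A = 1 \<and> Polynomial.lead_coeff B = 1"
  proof (induction I rule: infinite_finite_induct)
    case (insert i I)
    then obtain A B where AB: "(\<Prod>i\<in>I. linear_ratfun (\<rho> i) powi d i) = Fraction_Field.Fract A B"
      "Polynomial.lead_coeff A = 1" "Polynomial.lead_coeff B = 1" by blast
    obtain A' B' where AB': "linear_ratfun (\<rho> i) powi d i = Fraction_Field.Fract A' B'"
      "Polynomial.lead_coeff A' = 1" "Polynomial.lead_coeff B' = 1" using monic_frac by blast
    show ?case
      using insert AB AB' by (intro exI[of _ "A' * A"] exI[of _ "B' * B"]) (simp add: lead_coeff_mult)
  qed (auto simp: One_fract_def intro!: exI[of _ 1])
  then obtain A B where AB: "Fraction_Field.Fract (map_poly \<iota> f) (map_poly \<iota> g) = Fraction_Field.Fract A B"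
     "Polynomial.lead_coeff A = 1" "Polynomial.lead_coeff B = 1"
    using eq by metis
  have lc: "Polynomial.lead_coeff (map_poly \<iota> p) = \<iota> (Polynomial.lead_coeff p)" for p
    by (cases "p = 0") (simp_all add: \<iota>_0 \<iota>_nz lead_coeff_map_poly_nz)
  have "map_poly \<iota> g \<noteq> 0"
    using lc[of g] g \<iota>_nz by (metis leading_coeff_0_iff)
  moreover have "B \<noteq> 0" using AB by auto
  ultimately have "map_poly \<iota> f * B = A * map_poly \<iota> g"
    using AB(1) by (simp add: eq_fract)
  then have "\<iota> (Polynomial.lead_coeff f) = \<iota> (Polynomial.lead_coeff g)"
    using AB(2,3) by (metis lc lead_coeff_mult mult_1 mult_1_right)
  then show ?thesis by (rule \<iota>_inj)
qed

section \<open>Simple extensions of a field\<close>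

text \<open>
  A nonzero element \<open>D\<close> of least degree in the ideal generated by \<open>M\<close> and \<open>P\<close> divides both of them.
  As \<open>M\<close> is irreducible and does not divide \<open>P\<close>, it must be a unit.
\<close>
lemma irreducible_poly_bezout:
  fixes M P :: "'k::field poly"
  assumes irr: "irreducible M" and ndvd: "\<not> M dvd P"
  shows "\<exists>A B. A * M + B * P = 1"
proof -
  define I where "I = {A * M + B * P | A B. True}"
  have "M \<noteq> 0" using irr by auto
  have "M = 1 * M + 0 * P" by simp
  then have MI: "M \<in> I" unfolding I_def by blast
  have "P = 0 * M + 1 * P" by simp
  then have PI: "P \<in> I" unfolding I_def by blast
  have mult: "R * Q \<in> I" if Q: "Q \<in> I" for Q R
  proof -
    obtain A B where "Q = A * M + B * P" using Q unfolding I_def by blast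
    then have "R * Q = (R * A) * M + (R * B) * P" by (simp add: algebra_simps)
    then show ?thesis unfolding I_def by blast
  qed
  have diff: "Q - R \<in> I" if QR: "Q \<in> I" "R \<in> I" for Q R
  proof -
    obtain A B C D where "Q = A * M + B * P" "R = C * M + D * P" using QR unfolding I_def by blast
    then have "Q - R = (A - C) * M + (B - D) * P" by (simp add: algebra_simps)
    then show ?thesis unfolding I_def by blast
  qed
  obtain D where D: "D \<in> I" "D \<noteq> 0"
    and min: "\<And>Q. Q \<in> I \<Longrightarrow> Q \<noteq> 0 \<Longrightarrow> Polynomial.degree D \<le> Polynomial.degree Q"
    using ex_has_least_nat[of "\<lambda>Q. Q \<in> I \<and> Q \<noteq> 0" M Polynomial.degree] MI \<open>M \<noteq> 0\<close> by blast
  have D_dvd: "D dvd Q" if "Q \<in> I" for Q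
  proof -
    have "Q - Q div D * D \<in> I"
      by (rule diff[OF that mult[OF D(1)]])
    then have "Q mod D \<in> I"
      by (simp add: minus_div_mult_eq_mod)
    then show ?thesis
      using min[of "Q mod D"] degree_mod_less[of D Q] D(2) by (metis dvd_eq_mod_eq_0 not_le)
  qed
  from D_dvd[OF MI] obtain E where E: "M = D * E" by blast
  have "\<not> is_unit E"
  proof
    assume "is_unit E"
    then have "M dvd D" by (simp add: E)
    with D_dvd[OF PI] have "M dvd P" by (rule dvd_trans[rotated])
    with ndvd show False ..
  qed
  then have "is_unit D"
    using irr E by (auto dest: irreducibleD)
  then obtain D' where "D' * D = 1" by (metis dvdE mult.commute)
  with mult[OF D(1), of D'] show ?thesis by (auto simp: I_def)
qed

text \<open>
  Evaluation, in Horner form, of a polynomial over a field type at an element of a ring record,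
  the coefficients being transported along \<open>j\<close>.
\<close>
definition eval_via :: "('l, 'm) ring_scheme \<Rightarrow> ('k::zero \<Rightarrow> 'l) \<Rightarrow> 'l \<Rightarrow> 'k poly \<Rightarrow> 'l"
  where "eval_via L j z P = fold_coeffs (\<lambda>a v. j a \<oplus>\<^bsub>L\<^esub> z \<otimes>\<^bsub>L\<^esub> v) P \<zero>\<^bsub>L\<^esub>"

locale field_embedding = field L for L (structure) +
  fixes j :: "'k::field \<Rightarrow> 'a"
  assumes j_hom: "j \<in> ring_hom ring_of_type_algebra L"
begin

abbreviation ev where "ev \<equiv> eval_via L j"

lemma j_closed [simp]: "j a \<in> carrier L"
  using j_hom by (auto simp: ring_hom_def ring_of_type_algebra_def)

lemma j_add: "j (a + b) = j a \<oplus> j b"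
  using j_hom by (auto simp: ring_hom_def ring_of_type_algebra_def)

lemma j_mult: "j (a * b) = j a \<otimes> j b"
  using j_hom by (auto simp: ring_hom_def ring_of_type_algebra_def)

lemma j_one [simp]: "j 1 = \<one>"
  using j_hom by (auto simp: ring_hom_def ring_of_type_algebra_def)

lemma j_zero [simp]: "j 0 = \<zero>"
  using j_add[of 0 0] by (metis add.r_cancel_one add_cancel_right_left j_closed)

lemma j_minus: "j (- a) = \<ominus> j a"
  using j_add[of "- a" a] by (metis ab_left_minus j_closed j_zero minus_equality)

lemma j_power: "j (a ^ m) = j a [^] m"
  by (induction m) (simp_all add: j_mult m_comm)

lemma j_eq_zero_iff [simp]: "j a = \<zero> \<longleftrightarrow> a = 0"
proof
  assume "j a = \<zero>"
  show "a = 0"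
  proof (rule ccontr)
    assume "a \<noteq> 0"
    then have "\<one> = j a \<otimes> j (inverse a)" by (simp flip: j_mult)
    with \<open>j a = \<zero>\<close> show False by simp
  qed
qed simp

lemma j_inj: "inj j"
proof
  fix a b assume "j a = j b"
  then have "j (a + - b) = \<zero>" by (simp add: j_add j_minus r_neg del: j_eq_zero_iff add_uminus_conv_diff)
  then have "a + - b = 0" by (simp only: j_eq_zero_iff)
  then show "a = b" by simp
qed

lemma ev_0 [simp]: "ev z 0 = \<zero>"
  by (simp add: eval_via_def)

lemma ev_pCons [simp]:
  assumes "z \<in> carrier L"
  shows "ev z (pCons a P) = j a \<oplus> z \<otimes> ev z P"
  using assms by (cases "a = 0 \<and> P = 0") (auto simp: eval_via_def)

lemma ev_closed [simp]: "z \<in> carrier L \<Longrightarrow> ev z P \<in> carrier L"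
  by (induction P) auto

lemma ev_const [simp]: "z \<in> carrier L \<Longrightarrow> ev z [:a:] = j a"
  by simp

lemma ev_1 [simp]: "z \<in> carrier L \<Longrightarrow> ev z 1 = \<one>"
  by (simp add: one_pCons)

lemma ev_add: "z \<in> carrier L \<Longrightarrow> ev z (P + Q) = ev z P \<oplus> ev z Q"
proof (induction P Q rule: poly_induct2)
  case (pCons a P b Q)
  then show ?case by (simp add: j_add r_distr a_ac)
qed simp

lemma ev_smult: "z \<in> carrier L \<Longrightarrow> ev z (Polynomial.smult a P) = j a \<otimes> ev z P"
proof (induction P)
  case (pCons b P)
  then show ?case by (simp add: j_mult r_distr m_lcomm)
qed simp

lemma ev_mult: "z \<in> carrier L \<Longrightarrow> ev z (P * Q) = ev z P \<otimes> ev z Q"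
proof (induction P)
  case (pCons a P)
  then show ?case by (simp add: ev_add ev_smult l_distr m_assoc)
qed simp

lemma ev_minus: "z \<in> carrier L \<Longrightarrow> ev z (- P) = \<ominus> ev z P"
  using ev_add[of z "- P" P] by (metis ab_left_minus ev_0 ev_closed minus_equality)

lemma ev_diff: "z \<in> carrier L \<Longrightarrow> ev z (P - Q) = ev z P \<ominus> ev z Q"
  using ev_add[of z P "- Q"] by (simp add: ev_minus a_minus_def)

lemma ev_power: "z \<in> carrier L \<Longrightarrow> ev z (P ^ m) = ev z P [^] m"
  by (induction m) (simp_all add: ev_mult m_comm)

lemma ev_monom [simp]: "z \<in> carrier L \<Longrightarrow> ev z (Polynomial.monom 1 m) = z [^] m"
  by (induction m) (simp_all add: monom_Suc m_comm monom_0)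

text \<open>
  The relations satisfied by a root of an irreducible polynomial depend on the polynomial alone.
  Hence the roots of \<open>M\<close>, in one extension or in different ones, are algebraically
  indistinguishable over the base field.
\<close>
lemma ev_eq_zero_iff:
  assumes z: "z \<in> carrier L" and irr: "irreducible M" and root: "ev z M = \<zero>"
  shows "ev z P = \<zero> \<longleftrightarrow> M dvd P"
proof
  assume "ev z P = \<zero>"
  show "M dvd P"
  proof (rule ccontr)
    assume "\<not> M dvd P"
    then obtain A B where "A * M + B * P = 1"
      using irreducible_poly_bezout[OF irr] by blast
    then have "ev z (A * M + B * P) = \<one>" using z by simp
    then show False
      using z root \<open>ev z P = \<zero>\<close> by (simp add: ev_add ev_mult)
  qed
qed (use z root in \<open>auto simp: ev_mult\<close>)

lemma ev_eq_iff:
  assumes z: "z \<in> carrier L" and "irreducible M" "ev z M = \<zero>"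
  shows "ev z P = ev z Q \<longleftrightarrow> M dvd P - Q"
  using ev_eq_zero_iff[OF assms, of "P - Q"] z by (simp add: ev_diff)

text \<open>
  An algebraic element generates a field already by polynomial expressions: the inverse of the value
  of a polynomial is the value of its Bezout cofactor.
\<close>
lemma range_ev_eq_carrier:
  assumes z: "z \<in> carrier L" and irr: "irreducible M" and root: "ev z M = \<zero>"
    and gen: "carrier L = generate_field L (insert z (range j))"
  shows "range (ev z) = carrier L"
proof
  show "range (ev z) \<subseteq> carrier L" using z by auto
  show "carrier L \<subseteq> range (ev z)"
  proof
    fix v assume "v \<in> carrier L"
    then have "v \<in> generate_field L (insert z (range j))" using gen by simp
    then show "v \<in> range (ev z)"
    proof induction
      case one
      show ?case using ev_1[OF z] by (metis rangeI)
    next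
      case (incl h)
      have "ev z [:0, 1:] = z" using z by simp
      then show ?case using incl ev_const[OF z] by (metis insert_iff rangeE rangeI)
    next
      case (a_inv h)
      then obtain P where "h = ev z P" by blast
      then show ?case by (simp flip: ev_minus[OF z])
    next
      case (m_inv h)
      then obtain P where P: "h = ev z P" by blast
      with m_inv have "\<not> M dvd P" using ev_eq_zero_iff[OF z irr root] by simp
      then obtain A B where "A * M + B * P = 1"
        using irreducible_poly_bezout[OF irr] by blast
      then have "ev z (A * M + B * P) = \<one>" using z by simp
      then have "ev z B \<otimes> h = \<one>"
        using z root by (simp add: ev_add ev_mult P)
      then have "inv h = ev z B"
        using comm_inv_char[of h "ev z B"] z by (simp add: P m_comm)
      then show ?case by simp
    next
      case (eng_add h1 h2)
      then obtain P Q where "h1 = ev z P" "h2 = ev z Q" by blast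
      then show ?case by (simp flip: ev_add[OF z])
    next
      case (eng_mult h1 h2)
      then obtain P Q where "h1 = ev z P" "h2 = ev z Q" by blast
      then show ?case by (simp flip: ev_mult[OF z])
    qed
  qed
qed

end

text \<open>
  The target \<open>L'\<close> may be any field that contains a copy of the base field and a root of \<open>M\<close>.  With
  Laurent series it gives the place over \<open>\<infinity>\<close>, and with \<open>L\<close> itself the automorphisms.
\<close>
lemma simple_extension_hom_exists:
  assumes "field_embedding L j" and "field_embedding L' j'"
    and z: "z \<in> carrier L" and z': "z' \<in> carrier L'"
    and irr: "irreducible M"
    and root: "eval_via L j z M = \<zero>\<^bsub>L\<^esub>" and root': "eval_via L' j' z' M = \<zero>\<^bsub>L'\<^esub>"
    and gen: "carrier L = generate_field L (insert z (range j))"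
  shows "\<exists>\<sigma> \<in> ring_hom L L'. \<sigma> z = z' \<and> (\<forall>a. \<sigma> (j a) = j' a)"
proof -
  interpret L: field_embedding L j by fact
  interpret L': field_embedding L' j' by fact
  have ran: "range (L.ev z) = carrier L"
    by (rule L.range_ev_eq_carrier[OF z irr root gen])
  define \<sigma> where "\<sigma> v = L'.ev z' (SOME P. L.ev z P = v)" for v
  have \<sigma>: "\<sigma> (L.ev z P) = L'.ev z' P" for P
  proof -
    have "L.ev z (SOME Q. L.ev z Q = L.ev z P) = L.ev z P"
      by (rule someI_ex) blast
    then show ?thesis
      unfolding \<sigma>_def by (simp add: L.ev_eq_iff[OF z irr root] L'.ev_eq_iff[OF z' irr root'])
  qed
  have "\<sigma> \<in> ring_hom L L'"
  proof (rule ring_hom_memI)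
    fix v assume "v \<in> carrier L"
    then obtain P where P: "v = L.ev z P" using ran by blast
    show "\<sigma> v \<in> carrier L'" by (simp add: P \<sigma> z')
    fix w assume "w \<in> carrier L"
    then obtain Q where Q: "w = L.ev z Q" using ran by blast
    show "\<sigma> (v \<otimes>\<^bsub>L\<^esub> w) = \<sigma> v \<otimes>\<^bsub>L'\<^esub> \<sigma> w"
      using \<sigma>[of "P * Q"] by (simp add: P Q \<sigma> L.ev_mult L'.ev_mult z z')
    show "\<sigma> (v \<oplus>\<^bsub>L\<^esub> w) = \<sigma> v \<oplus>\<^bsub>L'\<^esub> \<sigma> w"
      using \<sigma>[of "P + Q"] by (simp add: P Q \<sigma> L.ev_add L'.ev_add z z')
  next
    show "\<sigma> \<one>\<^bsub>L\<^esub> = \<one>\<^bsub>L'\<^esub>"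
      using \<sigma>[of 1] by (simp add: z z')
  qed
  moreover have "\<sigma> z = z'" using \<sigma>[of "[:0, 1:]"] z z' by simp
  moreover have "\<sigma> (j a) = j' a" for a using \<sigma>[of "[:a:]"] z z' by simp
  ultimately show ?thesis by blast
qed

section \<open>Roots of unity and the rational place over infinity\<close>

lemma field_embedding_self:
  "field_embedding (ring_of_type_algebra :: 'f::field ring) h \<longleftrightarrow>
     h \<in> ring_hom ring_of_type_algebra (ring_of_type_algebra :: 'f ring)"
  by (simp add: field_embedding_def field_embedding_axioms_def field_from_type_algebra)

lemma nat_pow_ring_of_type_algebra:
  "(x :: 'f::field) [^]\<^bsub>ring_of_type_algebra\<^esub> (m::nat) = x ^ m"
  by (induction m) (simp_all add: ring_of_type_algebra_def nat_pow_def mult.commute)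

text \<open>
  The homomorphism is the substitution $x = t^{-n}$.  It takes a polynomial of degree \<open>m\<close> to $t^{-nm}$
  times a power series whose constant term is the leading coefficient.  This shows that it is
  injective, and also that a quotient of polynomials with equal leading coefficients becomes an
  \<open>n\<close>-th power: the power of \<open>t\<close> has an exponent divisible by \<open>n\<close>, and the remaining series has
  constant term \<open>1\<close>.
\<close>
lemma rational_place_over_infinity:
  assumes n: "of_nat n \<noteq> (0::'a::field)"
  obtains h :: "'a::field poly fract \<Rightarrow> 'a fls"
  where "h \<in> ring_hom ring_of_type_algebra ring_of_type_algebra"
    and "\<And>c. h (const_ratfun c) = fls_const c"
    and "\<And>f g. g \<noteq> 0 \<Longrightarrow> Polynomial.lead_coeff f = Polynomial.lead_coeff g \<Longrightarrow>
           \<exists>w. w ^ n = h (Fraction_Field.Fract f g)"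
proof -
  let ?F = "ring_of_type_algebra :: 'a fls ring"
  define T where "T = (fls_X :: 'a fls) ^ n"
  have "n > 0" using n by (cases n) auto
  have T0: "T \<noteq> 0" by (simp add: T_def)
  interpret field_embedding ?F fls_const
    unfolding field_embedding_self
    by (auto simp: ring_of_type_algebra_def fls_plus_const intro!: ring_hom_memI)
  have F_simps: "carrier ?F = UNIV" "a \<otimes>\<^bsub>?F\<^esub> b = a * b" "a \<oplus>\<^bsub>?F\<^esub> b = a + b"
    "\<one>\<^bsub>?F\<^esub> = 1" "\<zero>\<^bsub>?F\<^esub> = 0" for a b
    by (simp_all add: ring_of_type_algebra_def)
  define \<phi> where "\<phi> = ev (inverse T)"
  have \<phi>_pCons: "\<phi> (pCons a P) = fls_const a + inverse T * \<phi> P" for a P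
    by (simp add: \<phi>_def F_simps)
  \<comment> \<open>the expansion of a polynomial at infinity, cleared of its pole\<close>
  have lead: "\<exists>r. fps_nth r 0 = Polynomial.lead_coeff P \<and>
      \<phi> P * T ^ Polynomial.degree P = fps_to_fls r" for P
  proof (induction P)
    case 0
    show ?case by (rule exI[of _ 0]) (simp add: \<phi>_def F_simps)
  next
    case (pCons a P)
    show ?case
    proof (cases "P = 0")
      case True
      then show ?thesis
        by (intro exI[of _ "fps_const a"]) (simp add: \<phi>_def F_simps)
    next
      case False
      obtain r where r: "fps_nth r 0 = Polynomial.lead_coeff P"
        "\<phi> P * T ^ Polynomial.degree P = fps_to_fls r" using pCons.IH by blast
      have "\<phi> (pCons a P) * T ^ Polynomial.degree (pCons a P)
          = fls_const a * T ^ Suc (Polynomial.degree P) + \<phi> P * T ^ Polynomial.degree P"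
        using False T0 by (simp add: \<phi>_pCons algebra_simps)
      also have "\<dots> = fps_to_fls (fps_const a * (fps_X ^ n) ^ Suc (Polynomial.degree P) + r)"
        unfolding r(2) unfolding T_def
        by (simp add: fps_to_fls_power fls_times_fps_to_fls del: power_Suc)
      finally show ?thesis
        using False r(1) \<open>n > 0\<close>
        by (intro exI[of _ "fps_const a * (fps_X ^ n) ^ Suc (Polynomial.degree P) + r"])
          (simp add: fps_power_zeroth)
    qed
  qed
  have \<phi>_nz: "\<phi> P \<noteq> 0" if "P \<noteq> 0" for P
    using lead[of P] that by auto
  obtain h where h: "h \<in> ring_hom ring_of_type_algebra ?F"
    "\<And>a b. b \<noteq> 0 \<Longrightarrow> h (Fraction_Field.Fract a b) = \<phi> a / \<phi> b"
    using fraction_field_hom_exists[of \<phi>, OF _ _ _ \<phi>_nz]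
      ev_add[of "inverse T"] ev_mult[of "inverse T"] ev_1[of "inverse T"]
    by (auto simp: \<phi>_def F_simps)
  have power_quot: "(a ^ n) ^ k / (a ^ n) ^ l = (a ^ k / a ^ l) ^ n" for a :: "'a fls" and k l
    by (simp add: power_divide mult.commute flip: power_mult)
  have "h (const_ratfun c) = fls_const c" for c
    by (simp add: const_ratfun_def h(2) \<phi>_def F_simps one_pCons)
  moreover have "\<exists>w. w ^ n = h (Fraction_Field.Fract f g)"
    if g: "g \<noteq> 0" and lc: "Polynomial.lead_coeff f = Polynomial.lead_coeff g" for f g
  proof -
    obtain r s where r: "fps_nth r 0 = Polynomial.lead_coeff f"
        "\<phi> f * T ^ Polynomial.degree f = fps_to_fls r"
      and s: "fps_nth s 0 = Polynomial.lead_coeff g"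
        "\<phi> g * T ^ Polynomial.degree g = fps_to_fls s" using lead by metis
    have s0: "fps_nth s 0 \<noteq> 0" using g s by simp
    then have "fps_nth (r * inverse s) 0 = 1"
      using r(1) s(1) lc by (simp add: fps_inverse_def)
    then obtain w where w: "w ^ n = r * inverse s"
      using fps_nth_root_exists[OF _ n] by blast
    have "w ^ n * s = r"
      using s0 by (simp add: w mult.assoc inverse_mult_eq_1)
    then have "fps_to_fls w ^ n * (\<phi> g * T ^ Polynomial.degree g) = \<phi> f * T ^ Polynomial.degree f"
      unfolding r(2) s(2) by (metis fps_to_fls_power fls_times_fps_to_fls)
    then have "fps_to_fls w ^ n * (T ^ Polynomial.degree g / T ^ Polynomial.degree f) = h (Fraction_Field.Fract f g)"
      using \<phi>_nz[OF g] T0 g by (simp add: h(2) field_simps)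
    moreover have "T ^ Polynomial.degree g / T ^ Polynomial.degree f
        = (fls_X ^ Polynomial.degree g / fls_X ^ Polynomial.degree f) ^ n"
      using power_quot[of fls_X] by (simp only: T_def)
    ultimately show ?thesis
      by (metis power_mult_distrib)
  qed
  ultimately show thesis using that h(1) by blast
qed

text \<open>
  In the field of Laurent series the image of a root of unity is a constant, and homomorphisms of
  fields are injective; so it was that constant before.
\<close>
lemma roots_of_unity_are_constants:
  fixes j :: "'a::field poly fract \<Rightarrow> 'l"
  assumes L: "field_embedding L j"
    and y: "y \<in> carrier L" "y [^]\<^bsub>L\<^esub> n = j u"
    and irr: "irreducible (Polynomial.monom 1 n - [:u:])"
    and gen: "carrier L = generate_field L (insert y (range j))"
    and u: "g \<noteq> 0" "u = Fraction_Field.Fract f g"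
      "Polynomial.lead_coeff f = Polynomial.lead_coeff g"
    and n: "of_nat n \<noteq> (0::'a)"
    and z: "z \<in> carrier L" "z [^]\<^bsub>L\<^esub> n = \<one>\<^bsub>L\<^esub>"
  shows "\<exists>c. z = j (const_ratfun c)"
proof -
  let ?F = "ring_of_type_algebra :: 'a fls ring"
  interpret L: field_embedding L j by fact
  obtain h where h: "h \<in> ring_hom ring_of_type_algebra ?F"
    and h_const: "\<And>c. h (const_ratfun c) = fls_const c"
    and h_root: "\<And>f g. g \<noteq> 0 \<Longrightarrow> Polynomial.lead_coeff f = Polynomial.lead_coeff g \<Longrightarrow>
           \<exists>w. w ^ n = h (Fraction_Field.Fract f g)"
    using rational_place_over_infinity[OF n] by blast
  interpret F: field_embedding ?F h using h by (simp add: field_embedding_self)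
  have F_simps: "carrier ?F = UNIV" by (simp_all add: ring_of_type_algebra_def)
  obtain w where w: "w ^ n = h u" using h_root[OF u(1,3)] u(2) by blast
  have "F.ev w (Polynomial.monom 1 n - [:u:]) = \<zero>\<^bsub>?F\<^esub>"
    by (simp add: F.ev_diff F_simps nat_pow_ring_of_type_algebra w a_minus_def F.r_neg)
  moreover have "L.ev y (Polynomial.monom 1 n - [:u:]) = \<zero>\<^bsub>L\<^esub>"
    using y by (simp add: L.ev_diff a_minus_def L.r_neg)
  ultimately obtain \<sigma> where \<sigma>: "\<sigma> \<in> ring_hom L ?F" "\<And>a. \<sigma> (j a) = h a"
    using simple_extension_hom_exists[OF L F.field_embedding_axioms y(1) _ irr _ _ gen, of w]
    by (auto simp: F_simps)
  interpret \<sigma>: ring_hom_cring L ?F \<sigma>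
    by (rule UnivPoly.ring_hom_cringI[OF L.is_cring F.is_cring \<sigma>(1)])
  have "\<sigma> z ^ n = 1"
    using \<sigma>.hom_pow[OF z(1), of n] z(2)
    by (simp add: nat_pow_ring_of_type_algebra) (simp add: ring_of_type_algebra_def)
  then obtain c where "\<sigma> z = fls_const c"
    using fls_root_of_unity_is_const[OF _ n] by blast
  then have "\<sigma> z = \<sigma> (j (const_ratfun c))"
    by (simp add: \<sigma>(2) h_const)
  moreover have "inj_on \<sigma> (carrier L)"
    by (rule non_trivial_field_hom_is_inj[OF \<sigma>(1) L.field_axioms F.field_axioms])
  ultimately show ?thesis
    using z(1) by (auto dest: inj_onD)
qed

section \<open>Counting roots in a Galois extension\<close>

lemma degree_monom_minus_const:
  assumes "n \<ge> 1"
  shows "Polynomial.degree (Polynomial.monom 1 n - [:c :: 'k::field:]) = n"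
proof -
  have "Polynomial.degree [:c:] < Polynomial.degree (Polynomial.monom (1 :: 'k) n)"
    using assms by (simp add: degree_monom_eq)
  then show ?thesis
    by (metis degree_add_eq_left degree_minus degree_monom_eq diff_conv_add_uminus one_neq_zero)
qed

context field_embedding
begin

text \<open>
  Minimal polynomials and root multiplicities in ring records are about coefficient lists, highest
  coefficient first.  Every polynomial with coefficients in the image of \<open>j\<close> is such a list
  (\<open>list_poly_surj\<close>), and has the same degree and the same values, so divisibility and root
  counting can be moved between the two representations.
\<close>
definition list_poly :: "'k poly \<Rightarrow> 'a list"
  where "list_poly P = map j (rev (coeffs P))"

lemma list_poly_eq_Nil_iff [simp]: "list_poly P = [] \<longleftrightarrow> P = 0"
  by (simp add: list_poly_def)

lemma eval_list_poly:
  assumes z: "z \<in> carrier L"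
  shows "eval (list_poly P) z = ev z P"
proof (induction P)
  case (pCons a P)
  then have "list_poly (pCons a P) = list_poly P @ [j a]"
    by (auto simp: list_poly_def cCons_def)
  moreover have "set (list_poly P) \<subseteq> carrier L"
    by (auto simp: list_poly_def)
  ultimately show ?case
    using pCons z by (simp add: eval_append_aux m_comm a_comm)
qed (simp add: list_poly_def)

lemma list_poly_in_univ_poly: "list_poly P \<in> carrier ((range j)[X])"
proof (cases "P = 0")
  case False
  then have "hd (list_poly P) = j (Polynomial.lead_coeff P)"
    by (simp add: list_poly_def hd_map hd_rev last_coeffs_eq_coeff_degree)
  with False show ?thesis
    by (auto simp: univ_poly_carrier[symmetric] polynomial_def list_poly_def)
qed (simp add: univ_poly_carrier[symmetric] polynomial_def list_poly_def)

lemma list_poly_in_poly_ring: "list_poly P \<in> carrier (poly_ring L)"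
  using list_poly_in_univ_poly[of P]
  by (auto simp: univ_poly_carrier[symmetric] polynomial_def)

lemma list_poly_surj:
  assumes "p \<in> carrier ((range j)[X])"
  shows "\<exists>P. p = list_poly P"
proof (cases "p = []")
  case True
  then show ?thesis by (intro exI[of _ 0]) (simp add: list_poly_def)
next
  case False
  then have "set p \<subseteq> range j" "hd p \<noteq> \<zero>"
    using assms by (auto simp: univ_poly_carrier[symmetric] polynomial_def)
  then obtain xs where xs: "p = map j xs"
    by (metis ex_map_conv subsetD rangeE)
  then have "hd xs \<noteq> 0" "xs \<noteq> []"
    using \<open>hd p \<noteq> \<zero>\<close> False by (auto simp: hd_map)
  then have "coeffs (Poly (rev xs)) = rev xs"
    unfolding coeffs_Poly by (intro strip_while_idem) (cases xs, simp_all)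
  then show ?thesis
    by (intro exI[of _ "Poly (rev xs)"]) (simp add: list_poly_def xs)
qed

lemma length_list_poly: "length (list_poly P) - 1 = Polynomial.degree P"
  by (simp add: list_poly_def degree_eq_length_coeffs)

lemma card_roots_le_degree:
  assumes "P \<noteq> 0"
  shows "finite {z \<in> carrier L. ev z P = \<zero>}" (is "finite ?Z")
    and "card {z \<in> carrier L. ev z P = \<zero>} \<le> Polynomial.degree P"
proof -
  have Z: "?Z = set_mset (roots (list_poly P))"
    using assms eval_list_poly roots_mem_iff_is_root[OF list_poly_in_poly_ring[of P]]
    by (auto simp: is_root_def)
  show "finite ?Z" unfolding Z by simp
  have "card ?Z \<le> size (roots (list_poly P))"
    unfolding Z using size_mset_mono[OF mset_set_set_mset_msubset] by simp
  also have "\<dots> \<le> Polynomial.degree P"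
    using size_roots_le_degree[OF list_poly_in_poly_ring[of P]] by (simp add: length_list_poly[unfolded One_nat_def])
  finally show "card ?Z \<le> Polynomial.degree P" .
qed

text \<open>
  The minimal polynomial of \<open>y\<close> splits into distinct linear factors, so it has as many roots as its
  degree.  The irreducible \<open>M\<close> divides it, which bounds this degree below, and it divides \<open>M\<close>, which
  makes all its roots roots of \<open>M\<close>.
\<close>
lemma galois_imp_distinct_roots:
  assumes gal: "galois_over (range j)"
    and y: "y \<in> carrier L" and irr: "irreducible M" and root: "ev y M = \<zero>"
  shows "card {z \<in> carrier L. ev z M = \<zero>} = Polynomial.degree M"
proof (rule antisym)
  have "M \<noteq> 0" using irr by auto
  then show "card {z \<in> carrier L. ev z M = \<zero>} \<le> Polynomial.degree M"
    by (rule card_roots_le_degree)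
  let ?p = "Irr (range j) y"
  have K: "subfield (range j) L" and alg: "(algebraic over (range j)) y"
    and split: "splitted ?p"
    and simple: "\<And>b. b \<in> carrier L \<Longrightarrow> alg_mult ?p b \<le> 1"
    using gal y by (auto simp: galois_over_def)
  note Irr = IrrE[OF K y alg]
  obtain P where P: "?p = list_poly P" using list_poly_surj[OF Irr(1)] by blast
  have "P \<noteq> 0" using Irr(2) by (auto simp: P ring_irreducible_def univ_poly_zero)
  have p_in: "?p \<in> carrier (poly_ring L)" by (simp add: P list_poly_in_poly_ring)
  have "ev y P = \<zero>" using Irr(4) y by (simp add: P eval_list_poly)
  then have "M dvd P" using ev_eq_zero_iff[OF y irr root] by simp
  then have "Polynomial.degree M \<le> Polynomial.degree P"
    using \<open>P \<noteq> 0\<close> by (rule dvd_imp_degree_le)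
  also have "\<dots> = size (roots ?p)"
    using split by (simp add: splitted_def P length_list_poly[unfolded One_nat_def])
  also have "\<dots> = card (set_mset (roots ?p))"
  proof -
    have "count (roots ?p) b = 1" if "b \<in># roots ?p" for b
    proof -
      have "b \<in> carrier L"
        using that roots_mem_iff_is_root[OF p_in] by (simp add: is_root_def)
      then have "count (roots ?p) b \<le> 1"
        using simple alg_mult_eq_count_roots[OF p_in] by simp
      with that show ?thesis by (simp add: count_eq_zero_iff le_Suc_eq not_in_iff)
    qed
    then show ?thesis by (simp add: size_multiset_overloaded_eq)
  qed
  also have "\<dots> \<le> card {z \<in> carrier L. ev z M = \<zero>}"
  proof (rule card_mono)
    show "finite {z \<in> carrier L. ev z M = \<zero>}" by (rule card_roots_le_degree) fact
    have "eval (list_poly M) y = \<zero>" using y root by (simp add: eval_list_poly)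
    then have dvd: "?p pdivides list_poly M"
      by (rule Irr_minimal[OF K y alg list_poly_in_univ_poly])
    show "set_mset (roots ?p) \<subseteq> {z \<in> carrier L. ev z M = \<zero>}"
      using roots_mem_iff_is_root[OF p_in] pdivides_imp_root_sharing[OF p_in dvd]
      by (auto simp: is_root_def eval_list_poly)
  qed
  finally show "Polynomial.degree M \<le> card {z \<in> carrier L. ev z M = \<zero>}" .
qed

text \<open>
  Multiplication by \<open>y\<close> matches the \<open>n\<close>-th roots of unity with the roots of $Y^n - u$.
\<close>
lemma card_roots_of_unity:
  assumes gal: "galois_over (range j)" and n: "n \<ge> 1"
    and y: "y \<in> carrier L" "y [^] n = j u" and u: "u \<noteq> 0"
    and irr: "irreducible (Polynomial.monom 1 n - [:u:])"
  shows "card {z \<in> carrier L. z [^] n = \<one>} = n"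
proof -
  let ?M = "Polynomial.monom 1 n - [:u:]"
  have roots: "ev z ?M = \<zero> \<longleftrightarrow> z [^] n = j u" if "z \<in> carrier L" for z
    using that by (simp add: ev_diff)
  have "Polynomial.degree ?M = n"
    using n by (rule degree_monom_minus_const)
  then have "card {z \<in> carrier L. ev z ?M = \<zero>} = n"
    using galois_imp_distinct_roots[OF gal y(1) irr] roots y by simp
  moreover have "{z \<in> carrier L. ev z ?M = \<zero>} = {z \<in> carrier L. z [^] n = j u}"
    using roots by auto
  ultimately have card: "card {z \<in> carrier L. z [^] n = j u} = n" by simp
  have "y \<noteq> \<zero>"
  proof
    assume "y = \<zero>"
    then have "j u = \<zero>"
      using y(2)[symmetric] n by (simp add: nat_pow_zero del: j_eq_zero_iff)
    then show False using u by simp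
  qed
  then have y_unit: "y \<in> Units L" using y by (simp add: field_Units)
  then have inv_y: "inv y \<in> carrier L" "y \<otimes> inv y = \<one>" by simp_all
  have "bij_betw (\<lambda>z. y \<otimes> z) {z \<in> carrier L. z [^] n = \<one>} {z \<in> carrier L. z [^] n = j u}"
  proof (rule bij_betw_byWitness[where f' = "\<lambda>b. inv y \<otimes> b"])
    show "\<forall>z\<in>{z \<in> carrier L. z [^] n = \<one>}. inv y \<otimes> (y \<otimes> z) = z"
      using inv_y y by (simp add: m_assoc[symmetric] m_comm[of "inv y"])
    show "\<forall>b\<in>{z \<in> carrier L. z [^] n = j u}. y \<otimes> (inv y \<otimes> b) = b"
      using inv_y y by (simp add: m_assoc[symmetric])
    show "(\<lambda>z. y \<otimes> z) ` {z \<in> carrier L. z [^] n = \<one>} \<subseteq> {z \<in> carrier L. z [^] n = j u}"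
      using y by (auto simp: nat_pow_distrib)
    have "inv y [^] n \<otimes> j u = \<one>"
      using inv_y y by (metis nat_pow_distrib nat_pow_one m_comm)
    then show "(\<lambda>b. inv y \<otimes> b) ` {z \<in> carrier L. z [^] n = j u} \<subseteq> {z \<in> carrier L. z [^] n = \<one>}"
      using inv_y by (auto simp: nat_pow_distrib)
  qed
  with card show ?thesis by (simp add: bij_betw_same_card)
qed

text \<open>
  In characteristic \<open>p\<close> dividing \<open>n\<close>, the roots of unity would be the roots of $X^{n/p} - 1$, since
  $X^n - 1$ is the \<open>p\<close>-th power of this polynomial.
\<close>
lemma many_roots_of_unity_imp_char_not_dvd:
  assumes n: "n \<ge> 1" and card: "card {z \<in> carrier L. z [^] n = \<one>} = n"
  shows "of_nat n \<noteq> (0 :: 'k)"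
proof
  assume "of_nat n = (0 :: 'k)"
  then have dvd: "CHAR('k) dvd n" by (simp add: of_nat_eq_0_iff_char_dvd)
  then have "CHAR('k) > 0" using n by (auto intro: Nat.gr0I)
  then have p: "prime CHAR('k)" by (rule prime_CHAR_semidom)
  define p where "p = CHAR('k)"
  obtain m where m: "n = m * p" using dvd unfolding p_def by (metis dvd_def mult.commute)
  define Q where "Q = (Polynomial.monom 1 m - 1 :: 'k poly)"
  have "m \<ge> 1" using n m by (cases m) auto
  have Qdeg: "Polynomial.degree Q = m"
    using degree_monom_minus_const[OF \<open>m \<ge> 1\<close>, of "1 :: 'k"] by (simp add: Q_def one_pCons)
  then have "Q \<noteq> 0" using \<open>m \<ge> 1\<close> by auto
  have "(Q + 1) ^ p = Q ^ p + 1"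
    using freshmans_dream[where x = Q and y = 1 and n = p] p by (simp add: p_def)
  then have Qp: "Polynomial.monom 1 n - 1 = Q ^ p"
    by (simp add: Q_def m monom_power)
  have "{z \<in> carrier L. z [^] n = \<one>} \<subseteq> {z \<in> carrier L. ev z Q = \<zero>}"
  proof
    fix z assume z: "z \<in> {z \<in> carrier L. z [^] n = \<one>}"
    then have "ev z (Polynomial.monom 1 n - 1) = \<zero>"
      by (simp add: ev_diff)
    then have Qz: "ev z Q [^] p = \<zero>"
      using z by (simp add: Qp ev_power)
    have nilp: "v = \<zero>" if "v \<in> carrier L" "v [^] k = \<zero>" for v and k :: nat
      using that(2)
    proof (induction k)
      case (Suc k)
      then have "v [^] k \<otimes> v = \<zero>" by simp
      then show ?case using that(1) Suc.IH integral[of "v [^] k" v] by auto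
    qed simp
    show "z \<in> {z \<in> carrier L. ev z Q = \<zero>}"
      using z nilp[OF ev_closed Qz] by simp
  qed
  then have "card {z \<in> carrier L. z [^] n = \<one>} \<le> card {z \<in> carrier L. ev z Q = \<zero>}"
    by (rule card_mono[OF card_roots_le_degree(1)[OF \<open>Q \<noteq> 0\<close>]])
  also have "\<dots> \<le> m"
    using card_roots_le_degree(2)[OF \<open>Q \<noteq> 0\<close>] by (simp only: Qdeg)
  finally have "n \<le> m" by (simp only: card)
  moreover have "p \<ge> 2" using p by (simp add: p_def prime_ge_2_nat)
  ultimately show False using m \<open>m \<ge> 1\<close> by simp
qed

end

section \<open>The Galois group of a Kummer extension\<close>

text \<open>
  By Lagrange, \<open>n\<close> divides the order of the multiplicative group, which is cyclic; if \<open>m\<close> is the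
  quotient, the \<open>m\<close>-th power of a generator has order \<open>n\<close>.
\<close>
lemma roots_of_unity_generated:
  assumes n: "n \<ge> 1" and card: "card {c :: 'a::{field,finite}. c ^ n = 1} = n"
  shows "\<exists>\<zeta>. \<zeta> ^ n = 1 \<and> bij_betw (\<lambda>k. \<zeta> ^ k) {..<n} {c :: 'a. c ^ n = 1}"
proof -
  let ?R = "ring_of_type_algebra :: 'a ring"
  let ?U = "Multiplicative_Group.mult_of ?R"
  interpret R: field ?R by (rule field_from_type_algebra)
  interpret G: Group.group ?U by (rule R.field_mult_group)
  have carrier: "carrier ?U = - {0}"
    by (auto simp: ring_of_type_algebra_def)
  have ops: "a \<otimes>\<^bsub>?R\<^esub> b = a * b" "\<one>\<^bsub>?R\<^esub> = 1" for a b
    by (simp_all add: ring_of_type_algebra_def)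
  have pow: "a [^]\<^bsub>?U\<^esub> k = a ^ k" for a and k :: nat
    by (simp add: Multiplicative_Group.nat_pow_mult_of nat_pow_ring_of_type_algebra)
  let ?C = "{c :: 'a. c ^ n = 1}"
  have "subgroup ?C ?U"
  proof (rule G.subgroupI)
    show sub: "?C \<subseteq> carrier ?U" unfolding carrier using n by (auto simp: power_0_left)
    show "?C \<noteq> {}" by (auto intro: exI[of _ 1])
    fix a assume a: "a \<in> ?C"
    have "a \<noteq> 0" using a n by (auto simp: power_0_left)
    then have "inv\<^bsub>?U\<^esub> a = inverse a"
      by (intro G.inv_equality) (auto simp: ring_of_type_algebra_def)
    then show "inv\<^bsub>?U\<^esub> a \<in> ?C" using a by (simp add: power_inverse)
    fix b assume "b \<in> ?C"
    then show "a \<otimes>\<^bsub>?U\<^esub> b \<in> ?C" using a by (simp add: ops power_mult_distrib)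
  qed
  then have "n dvd Coset.order ?U"
    using G.lagrange card by (metis dvd_triv_right)
  then obtain m where m: "Coset.order ?U = n * m" by (rule dvdE)
  have fin: "finite (carrier ?U)" by simp
  obtain a where a: "a \<in> carrier ?U"
    and gen: "carrier ?U = {a [^]\<^bsub>?R\<^esub> i | i :: nat. i \<in> UNIV}"
    using R.finite_field_mult_group_has_gen by auto
  have "Coset.order ?U \<le> card {0..G.ord a - 1}"
  proof -
    have "carrier ?U = (\<lambda>i. a [^]\<^bsub>?U\<^esub> i) ` {0..G.ord a - 1}"
      using gen G.ord_elems[OF fin a] by (simp add: Multiplicative_Group.nat_pow_mult_of) auto
    then show ?thesis
      unfolding Coset.order_def by (metis card_image_le finite_atLeastAtMost)
  qed
  then have "{..<n * m} \<subseteq> {0..G.ord a - 1}" by (auto simp: m)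
  then have inj_a: "inj_on (\<lambda>i. a ^ i) {..<n * m}"
    using G.ord_inj[OF a] by (auto simp: pow intro: inj_on_subset)
  define \<zeta> where "\<zeta> = a ^ m"
  have \<zeta>n: "\<zeta> ^ n = 1"
    using G.pow_order_eq_1[OF a] by (simp add: m pow ops \<zeta>_def mult.commute flip: power_mult)
  have "m > 0"
    using m fin a by (metis G.order_gt_0_iff_finite mult_0_right neq0_conv)
  have inj: "inj_on (\<lambda>k. \<zeta> ^ k) {..<n}"
  proof (rule inj_onI)
    fix k l assume kl: "k \<in> {..<n}" "l \<in> {..<n}" "\<zeta> ^ k = \<zeta> ^ l"
    then have "a ^ (m * k) = a ^ (m * l)" by (simp add: \<zeta>_def power_mult)
    moreover have "m * k \<in> {..<n * m}" "m * l \<in> {..<n * m}"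
      using kl \<open>m > 0\<close> by (auto simp: mult.commute)
    ultimately have "m * k = m * l" by (intro inj_onD[OF inj_a])
    then show "k = l" using \<open>m > 0\<close> by simp
  qed
  have "(\<lambda>k. \<zeta> ^ k) ` {..<n} = ?C"
  proof (rule card_subset_eq)
    show "(\<lambda>k. \<zeta> ^ k) ` {..<n} \<subseteq> ?C"
      using \<zeta>n by (auto simp: power_commutes simp flip: power_mult) (metis mult.commute power_mult power_one)
  qed (use card inj in \<open>auto simp: card_image\<close>)
  with inj \<zeta>n show ?thesis by (auto simp: bij_betw_def)
qed

context field_embedding
begin

lemma hom_ev:
  fixes \<sigma> :: "'a \<Rightarrow> 'a"
  assumes \<sigma>: "\<sigma> \<in> ring_hom L L" "\<And>a. \<sigma> (j a) = j a" and z: "z \<in> carrier L"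
  shows "\<sigma> (ev z P) = ev (\<sigma> z) P"
proof (induction P)
  case 0
  show ?case using \<sigma>(2)[of 0] by simp
next
  case (pCons a P)
  then show ?case
    using z ring_hom_closed[OF \<sigma>(1)]
    by (simp add: ring_hom_add[OF \<sigma>(1)] ring_hom_mult[OF \<sigma>(1)] \<sigma>(2))
qed

text \<open>
  Only surjectivity is at stake; the image is a subfield, so it suffices that it contains generators.
\<close>
lemma field_autI:
  fixes \<sigma> :: "'a \<Rightarrow> 'a"
  assumes \<sigma>: "\<sigma> \<in> ring_hom L L" "\<And>a. \<sigma> (j a) = j a" and ext: "\<sigma> \<in> extensional (carrier L)"
    and y: "y \<in> \<sigma> ` carrier L"
    and gen: "carrier L = generate_field L (insert y (range j))"
  shows "\<sigma> \<in> field_aut L (range j)"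
proof -
  interpret \<sigma>: ring_hom_ring L L \<sigma>
    by (rule ring_hom_ringI2[OF ring_axioms ring_axioms \<sigma>(1)])
  have "subfield (\<sigma> ` carrier L) L"
    by (rule \<sigma>.img_is_subfield(2)[OF carrier_is_subfield one_not_zero])
  moreover have "insert y (range j) \<subseteq> \<sigma> ` carrier L"
  proof -
    have "j a \<in> \<sigma> ` carrier L" for a
      by (rule image_eqI[where x = "j a"]) (simp_all add: \<sigma>(2))
    with y show ?thesis by auto
  qed
  moreover have "insert y (range j) \<subseteq> carrier L"
    using y ring_hom_closed[OF \<sigma>(1)] by auto
  ultimately have "carrier L \<subseteq> \<sigma> ` carrier L"
    using generate_field_min_subfield1 gen by metis
  then have "bij_betw \<sigma> (carrier L) (carrier L)"
    using non_trivial_field_hom_is_inj[OF \<sigma>(1) field_axioms field_axioms] ring_hom_closed[OF \<sigma>(1)]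
    by (auto simp: bij_betw_def)
  then show ?thesis
    using \<sigma> ext by (auto simp: field_aut_def Bij_def)
qed

lemma field_aut_eqI:
  fixes \<sigma> \<tau> :: "'a \<Rightarrow> 'a"
  assumes "\<sigma> \<in> field_aut L (range j)" "\<tau> \<in> field_aut L (range j)" "\<sigma> y = \<tau> y"
    and y: "y \<in> carrier L" and ran: "range (ev y) = carrier L"
  shows "\<sigma> = \<tau>"
proof (rule extensionalityI)
  show "\<sigma> \<in> extensional (carrier L)" "\<tau> \<in> extensional (carrier L)"
    using assms(1,2) by (auto simp: field_aut_def Bij_def)
  fix v assume "v \<in> carrier L"
  then obtain P where "v = ev y P" using ran by blast
  then show "\<sigma> v = \<tau> v"
    using assms(1-3) y by (auto simp: field_aut_def hom_ev)
qed

text \<open>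
  The isomorphism sends the residue class of \<open>k\<close> to the automorphism with \<open>y \<mapsto> \<zeta>\<^sup>k y\<close>, which exists
  because \<open>\<zeta>\<^sup>k y\<close> is another root of the irreducible polynomial of \<open>y\<close>.  As \<open>y\<close> generates \<open>L\<close>,
  equations between automorphisms may be checked at \<open>y\<close>.
\<close>
lemma kummer_galois_group:
  assumes n: "n \<ge> 1"
    and y: "y \<in> carrier L" "y \<noteq> \<zero>" "y [^] n = j u"
    and irr: "irreducible (Polynomial.monom 1 n - [:u:])"
    and gen: "carrier L = generate_field L (insert y (range j))"
    and inj: "inj_on (\<lambda>k. \<zeta> ^ k) {..<n}" and \<zeta>: "\<zeta> ^ n = 1"
    and roots: "\<And>z. z \<in> carrier L \<Longrightarrow> z [^] n = \<one> \<Longrightarrow> \<exists>k<n. z = j (\<zeta> ^ k)"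
  shows "field_aut_group L (range j) \<cong> integer_mod_group n"
proof -
  let ?G = "field_aut_group L (range j)"
  have root: "ev z (Polynomial.monom 1 n - [:u:]) = \<zero>" if "z \<in> carrier L" "z [^] n = j u" for z
    using that by (simp add: ev_diff)
  have ran: "range (ev y) = carrier L"
    by (rule range_ev_eq_carrier[OF y(1) irr root[OF y(1,3)] gen])
  have "Group.group ?G" by (rule group_field_aut_group) auto
  have y_cancel: "a = b" if "j a \<otimes> y = j b \<otimes> y" for a b
    using that y m_rcancel[of y "j a" "j b"] j_inj by (auto dest: injD)
  \<comment> \<open>the automorphism that multiplies \<open>y\<close> by a given root of unity\<close>
  have "\<exists>\<sigma>. \<sigma> \<in> field_aut L (range j) \<and> \<sigma> y = j (\<zeta> ^ k) \<otimes> y" for k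
  proof -
    have "(\<zeta> ^ k) ^ n = 1" using \<zeta> by (metis mult.commute power_mult power_one)
    then have "(j (\<zeta> ^ k) \<otimes> y) [^] n = j u"
      using y by (simp add: nat_pow_distrib flip: j_power)
    then have "ev (j (\<zeta> ^ k) \<otimes> y) (Polynomial.monom 1 n - [:u:]) = \<zero>"
      using y by (intro root) auto
    then obtain \<sigma> where \<sigma>: "\<sigma> \<in> ring_hom L L" "\<sigma> y = j (\<zeta> ^ k) \<otimes> y" "\<And>a. \<sigma> (j a) = j a"
      using simple_extension_hom_exists[OF field_embedding_axioms field_embedding_axioms y(1) _ irr
          root[OF y(1,3)] _ gen, of "j (\<zeta> ^ k) \<otimes> y"] y(1) by auto
    \<comment> \<open>automorphisms are extensional functions, homomorphisms need not be\<close>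
    define \<tau> where "\<tau> = restrict \<sigma> (carrier L)"
    have \<tau>: "\<tau> \<in> ring_hom L L" "\<tau> y = j (\<zeta> ^ k) \<otimes> y" "\<And>a. \<tau> (j a) = j a"
      using \<sigma> y by (auto simp: \<tau>_def ring_hom_def)
    have "\<zeta> \<noteq> 0" using \<zeta> n by (auto simp: power_0_left)
    then have "j (inverse (\<zeta> ^ k)) \<otimes> (j (\<zeta> ^ k) \<otimes> y) = y"
      using y by (simp add: m_assoc[symmetric] flip: j_mult)
    then have "\<tau> (j (inverse (\<zeta> ^ k)) \<otimes> y) = y"
      using y by (simp add: ring_hom_mult[OF \<tau>(1)] \<tau>)
    then have "y \<in> \<tau> ` carrier L"
      using y by (metis image_eqI j_closed m_closed)
    moreover have "\<tau> \<in> extensional (carrier L)" by (simp add: \<tau>_def)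
    ultimately have "\<tau> \<in> field_aut L (range j)"
      by (intro field_autI[OF \<tau>(1,3) _ _ gen])
    with \<tau>(2) show ?thesis by blast
  qed
  then obtain A where A: "\<And>k. A k \<in> field_aut L (range j)" "\<And>k. A k y = j (\<zeta> ^ k) \<otimes> y"
    by metis
  define h where "h i = A (nat i)" for i :: int
  have "h \<in> iso (integer_mod_group n) ?G"
  proof (rule isoI)
    show "h \<in> hom (integer_mod_group n) ?G"
    proof (rule homI)
      fix a b assume a: "a \<in> carrier (integer_mod_group n)" and b: "b \<in> carrier (integer_mod_group n)"
      show "h a \<in> carrier ?G" by (simp add: h_def field_aut_group_def A)
      have mult: "h a \<otimes>\<^bsub>?G\<^esub> h b = compose (carrier L) (h a) (h b)"
        using A(1) by (auto simp: field_aut_group_def BijGroup_def h_def field_aut_def)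
      have "h a \<otimes>\<^bsub>?G\<^esub> h b \<in> carrier ?G"
        using A(1) by (intro monoid.m_closed[OF group.is_monoid[OF \<open>Group.group ?G\<close>]])
          (simp_all add: h_def field_aut_group_def)
      then have mem: "h a \<otimes>\<^bsub>?G\<^esub> h b \<in> field_aut L (range j)"
        by (simp add: field_aut_group_def)
      show "h (a \<otimes>\<^bsub>integer_mod_group n\<^esub> b) = h a \<otimes>\<^bsub>?G\<^esub> h b"
      proof (rule field_aut_eqI[OF _ mem _ y(1) ran])
        show "h (a \<otimes>\<^bsub>integer_mod_group n\<^esub> b) \<in> field_aut L (range j)" by (simp add: h_def A)
        have ab: "0 \<le> a" "0 \<le> b" using a b n by (auto simp: carrier_integer_mod_group)
        have "nat ((a + b) mod int n) = (nat a + nat b) mod n"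
          using ab by (simp add: nat_mod_distrib nat_add_distrib)
        moreover have "\<zeta> ^ (m mod n) = \<zeta> ^ m" for m
        proof -
          have "\<zeta> ^ m = \<zeta> ^ (n * (m div n) + m mod n)" by simp
          also have "\<dots> = \<zeta> ^ (m mod n)" by (simp only: power_add power_mult \<zeta>) simp
          finally show ?thesis by simp
        qed
        ultimately have "h (a \<otimes>\<^bsub>integer_mod_group n\<^esub> b) y = j (\<zeta> ^ (nat a + nat b)) \<otimes> y"
          by (simp add: h_def A)
        also have "\<dots> = h a (h b y)"
        proof -
          have hom: "h a \<in> ring_hom L L" and fix_j: "h a (j c) = j c" for c
            using A(1)[of "nat a"] by (auto simp: h_def field_aut_def)
          have "h a (h b y) = j (\<zeta> ^ nat b) \<otimes> (j (\<zeta> ^ nat a) \<otimes> y)"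
            using A(2)[of "nat a"] A(2)[of "nat b"] y by (simp add: h_def[of b] ring_hom_mult[OF hom] fix_j) (simp add: h_def)
          then show ?thesis
            using y by (simp add: power_add j_mult m_assoc m_lcomm)
        qed
        finally show "h (a \<otimes>\<^bsub>integer_mod_group n\<^esub> b) y = (h a \<otimes>\<^bsub>?G\<^esub> h b) y"
          using y by (simp add: mult compose_def)
      qed
    qed
    show "bij_betw h (carrier (integer_mod_group n)) (carrier ?G)"
    proof (rule bij_betwI')
      fix a b assume ab: "a \<in> carrier (integer_mod_group n)" "b \<in> carrier (integer_mod_group n)"
      then have b: "0 \<le> a" "a < int n" "0 \<le> b" "b < int n"
        using n by (auto simp: carrier_integer_mod_group)
      show "h a = h b \<longleftrightarrow> a = b"
      proof
        assume "h a = h b"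
        then have "j (\<zeta> ^ nat a) \<otimes> y = j (\<zeta> ^ nat b) \<otimes> y"
          using A(2) by (metis h_def)
        then have "\<zeta> ^ nat a = \<zeta> ^ nat b" by (rule y_cancel)
        then have "nat a = nat b" using b by (intro inj_onD[OF inj]) auto
        then show "a = b" using b by simp
      qed simp
    next
      fix a assume "a \<in> carrier (integer_mod_group n)"
      show "h a \<in> carrier ?G" by (simp add: h_def field_aut_group_def A)
    next
      fix \<sigma> assume "\<sigma> \<in> carrier ?G"
      then have \<sigma>: "\<sigma> \<in> field_aut L (range j)" by (simp add: field_aut_group_def)
      then have hom: "\<sigma> \<in> ring_hom L L" and fix_j: "\<sigma> (j c) = j c" for c
        by (auto simp: field_aut_def)
      interpret \<sigma>: ring_hom_ring L L \<sigma>
        by (rule ring_hom_ringI2[OF ring_axioms ring_axioms hom])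
      have \<sigma>y: "\<sigma> y \<in> carrier L" using y by simp
      have "\<sigma> y [^] n = j u" using \<sigma>.hom_nat_pow[OF y(1), of n] by (simp add: y(3) fix_j)
      have inv_y: "inv y \<in> carrier L" "inv y \<otimes> y = \<one>"
        using y field_Units by (auto intro: Units_l_inv)
      have "(\<sigma> y \<otimes> inv y) [^] n = \<one>"
        using inv_y y \<sigma>y \<open>\<sigma> y [^] n = j u\<close>
        by (metis m_comm nat_pow_distrib nat_pow_one)
      then obtain k where k: "k < n" "\<sigma> y \<otimes> inv y = j (\<zeta> ^ k)"
        using roots[of "\<sigma> y \<otimes> inv y"] inv_y \<sigma>y by auto
      have "\<sigma> y = \<sigma> y \<otimes> inv y \<otimes> y"
        using inv_y y \<sigma>y by (simp add: m_assoc)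
      then have "\<sigma> y = h (int k) y"
        by (simp add: k h_def A)
      then have "\<sigma> = h (int k)"
        by (intro field_aut_eqI[OF \<sigma> _ _ y(1) ran]) (simp_all add: h_def A)
      moreover have "int k \<in> carrier (integer_mod_group n)"
        using k n by (simp add: carrier_integer_mod_group)
      ultimately show "\<exists>a\<in>carrier (integer_mod_group n). \<sigma> = h a" by blast
    qed
  qed
  then have "integer_mod_group n \<cong> ?G" by (rule is_isoI)
  then show ?thesis using group.iso_sym[OF group_integer_mod_group] by blast
qed

end

lemma cyclic_integer_mod_group: "cyclic_group (integer_mod_group n)"
proof (cases "n = 0")
  case True
  then show ?thesis using cyclic_integer_group by (simp add: integer_mod_group_def)
next
  case False
  have "\<exists>x\<in>carrier (integer_mod_group n).
      carrier (integer_mod_group n) = range (\<lambda>m::int. x [^]\<^bsub>integer_mod_group n\<^esub> m)"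
  proof (intro bexI[of _ "1 mod int n"])
    show "1 mod int n \<in> carrier (integer_mod_group n)"
      using False by (simp add: carrier_integer_mod_group)
    show "carrier (integer_mod_group n) = range (\<lambda>m::int. (1 mod int n) [^]\<^bsub>integer_mod_group n\<^esub> m)"
    proof -
      have pow: "(1 mod int n) [^]\<^bsub>integer_mod_group n\<^esub> m = m mod int n" for m :: int
        by (simp add: int_pow_integer_mod_group mod_mult_right_eq)
      have "{0..<int n} = range (\<lambda>m. m mod int n)"
      proof
        show "{0..<int n} \<subseteq> range (\<lambda>m. m mod int n)"
        proof
          fix i assume "i \<in> {0..<int n}"
          then have "i = i mod int n" by simp
          then show "i \<in> range (\<lambda>m. m mod int n)" by (rule range_eqI)
        qed
      qed (use False in auto)
      then show ?thesis using False by (simp add: carrier_integer_mod_group pow)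
    qed
  qed
  then show ?thesis using group.cyclic_group[OF group_integer_mod_group] by blast
qed

section \<open>Cyclicity of the covering\<close>

theorem lemma2p4:
  fixes n s :: nat
    and d :: "nat \<Rightarrow> int"
    and \<iota> :: "'a::{field, finite} \<Rightarrow> 'b::alg_closed_field"
    and \<rho> :: "nat \<Rightarrow> 'b"
    and f g :: "'a poly"
    and u :: "'a poly fract"
    and L :: "('l, 'm) ring_scheme"
    and j :: "'a poly fract \<Rightarrow> 'l"
    and y :: 'l
  assumes "n \<ge> 1" and "s \<ge> 1"
    and embedding: "\<iota> \<in> ring_hom ring_of_type_algebra ring_of_type_algebra"
    and distinct: "inj_on \<rho> {1..s}"
    and u: "g \<noteq> 0" "u = Fraction_Field.Fract f g"
      "Fraction_Field.Fract (map_poly \<iota> f) (map_poly \<iota> g) =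
         (\<Prod>i=1..s. linear_ratfun (\<rho> i) powi d i)"
    and irreducible: "irreducible (Polynomial.monom 1 n - [:u:])"
    and function_field: "field L" "j \<in> ring_hom ring_of_type_algebra L"
      "y \<in> carrier L" "y [^]\<^bsub>L\<^esub> n = j u"
      "carrier L = generate_field L (insert y (range j))"
    and galois: "galois_extension L (range j)"
  shows "cyclic_galois_extension L (range j) \<and>
    (\<exists>H. subgroup H (field_aut_group L (range (j \<circ> const_ratfun))) \<and>
      cyclic_group (field_aut_group L (range (j \<circ> const_ratfun)) \<lparr>carrier := H\<rparr>) \<and>
      field_aut_group L (range (j \<circ> const_ratfun)) \<lparr>carrier := H\<rparr> \<cong> integer_mod_group n)"
proof -
  interpret field_embedding L j
    using function_field by (simp add: field_embedding_def field_embedding_axioms_def)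
  let ?K = "range j" and ?k = "range (j \<circ> const_ratfun)"
  have lc: "Polynomial.lead_coeff f = Polynomial.lead_coeff g"
    by (rule lead_coeffs_of_monic_product[OF embedding u(1,3)])
  then have "f \<noteq> 0" using u(1) by auto
  then have u_nz: "u \<noteq> 0"
    using u(1) unfolding u(2) by (simp add: Zero_fract_def eq_fract)
  have card: "card {z \<in> carrier L. z [^]\<^bsub>L\<^esub> n = \<one>\<^bsub>L\<^esub>} = n"
    by (rule card_roots_of_unity[OF galois \<open>n \<ge> 1\<close> function_field(3,4) u_nz irreducible])
  have char_poly: "of_nat n \<noteq> (0 :: 'a poly fract)"
    by (rule many_roots_of_unity_imp_char_not_dvd[OF \<open>n \<ge> 1\<close> card])
  have char: "of_nat n \<noteq> (0 :: 'a)"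
    using char_poly by (auto simp: of_nat_eq_const_ratfun const_ratfun_def Zero_fract_def)
  define k where "k c = j (const_ratfun c)" for c
  have k_inj: "inj k"
    by (rule injI) (auto simp: k_def dest!: injD[OF j_inj] const_ratfun_inj)
  have k_power: "k (c ^ m) = k c [^]\<^bsub>L\<^esub> m" for c m
    by (simp add: k_def const_ratfun_power j_power)
  have k_one: "k 1 = \<one>\<^bsub>L\<^esub>"
    using k_power[of 1 0] by simp
  have roots_const: "\<exists>c. z = k c" if "z \<in> carrier L" "z [^]\<^bsub>L\<^esub> n = \<one>\<^bsub>L\<^esub>" for z
    unfolding k_def
    by (rule roots_of_unity_are_constants[OF field_embedding_axioms function_field(3,4) irreducible
          function_field(5) u(1,2) lc char that])
  have "k ` {c. c ^ n = 1} = {z \<in> carrier L. z [^]\<^bsub>L\<^esub> n = \<one>\<^bsub>L\<^esub>}"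
  proof
    show "k ` {c. c ^ n = 1} \<subseteq> {z \<in> carrier L. z [^]\<^bsub>L\<^esub> n = \<one>\<^bsub>L\<^esub>}"
      using k_one by (auto simp flip: k_power) (simp add: k_def)
    show "{z \<in> carrier L. z [^]\<^bsub>L\<^esub> n = \<one>\<^bsub>L\<^esub>} \<subseteq> k ` {c. c ^ n = 1}"
    proof
      fix z assume z: "z \<in> {z \<in> carrier L. z [^]\<^bsub>L\<^esub> n = \<one>\<^bsub>L\<^esub>}"
      then obtain c where c: "z = k c" using roots_const by blast
      with z have "k (c ^ n) = k 1" by (simp add: k_power k_one)
      then have "c ^ n = 1" using k_inj by (auto dest: injD)
      with c show "z \<in> k ` {c. c ^ n = 1}" by blast
    qed
  qed
  then have "card {c :: 'a. c ^ n = 1} = n"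
    using card card_image[OF inj_on_subset[OF k_inj subset_UNIV]] by metis
  then obtain \<zeta> :: 'a where \<zeta>n: "\<zeta> ^ n = 1" and \<zeta>: "bij_betw (\<lambda>i. \<zeta> ^ i) {..<n} {c. c ^ n = 1}"
    using roots_of_unity_generated[OF \<open>n \<ge> 1\<close>] by blast
  have iso: "field_aut_group L ?K \<cong> integer_mod_group n"
  proof (rule kummer_galois_group[where \<zeta> = "const_ratfun \<zeta>"])
    show "y \<noteq> \<zero>\<^bsub>L\<^esub>"
    proof
      assume "y = \<zero>\<^bsub>L\<^esub>"
      then have "j u = \<zero>\<^bsub>L\<^esub>"
        using function_field(4)[symmetric] \<open>n \<ge> 1\<close> by (simp add: nat_pow_zero del: j_eq_zero_iff)
      then show False using u_nz by simp
    qed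
    show "const_ratfun \<zeta> ^ n = 1"
      by (simp add: const_ratfun_power[symmetric] \<zeta>n const_ratfun_one)
    have "inj_on (\<lambda>i. \<zeta> ^ i) {..<n}" using \<zeta> by (rule bij_betw_imp_inj_on)
    then show "inj_on (\<lambda>i. const_ratfun \<zeta> ^ i) {..<n}"
      by (auto simp: inj_on_def dest!: const_ratfun_inj simp flip: const_ratfun_power)
    fix z assume z: "z \<in> carrier L" "z [^]\<^bsub>L\<^esub> n = \<one>\<^bsub>L\<^esub>"
    then obtain c where c: "z = k c" using roots_const by blast
    with z have "k (c ^ n) = k 1" by (simp add: k_power k_one)
    then have "c ^ n = 1" using k_inj by (auto dest: injD)
    then obtain i where "i < n" "c = \<zeta> ^ i"
      using bij_betw_imp_surj_on[OF \<zeta>] by blast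
    then show "\<exists>i<n. z = j (const_ratfun \<zeta> ^ i)"
      using c by (auto simp: k_def const_ratfun_power)
  qed (use function_field irreducible \<open>n \<ge> 1\<close> in auto)
  have group_K: "Group.group (field_aut_group L ?K)" and group_k: "Group.group (field_aut_group L ?k)"
    by (auto intro!: group_field_aut_group)
  have cyclic: "cyclic_group (field_aut_group L ?K)"
    using isomorphic_group_cyclicity[OF iso group_K group_integer_mod_group] cyclic_integer_mod_group
    by simp
  let ?H = "field_aut L ?K"
  \<comment> \<open>both groups are carved out of the bijections of \<open>L\<close>, so the operation is the same\<close>
  have restrict: "(field_aut_group L ?k)\<lparr>carrier := ?H\<rparr> = field_aut_group L ?K"
    by (simp add: field_aut_group_def)
  have "subgroup ?H (field_aut_group L ?k)"
  proof (rule group.group_incl_imp_subgroup[OF group_k])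
    show "?H \<subseteq> carrier (field_aut_group L ?k)"
      by (auto simp: field_aut_group_def field_aut_def)
    show "Group.group ((field_aut_group L ?k)\<lparr>carrier := ?H\<rparr>)"
      using group_K by (simp only: restrict)
  qed
  then have "\<exists>H. subgroup H (field_aut_group L ?k) \<and>
      cyclic_group ((field_aut_group L ?k)\<lparr>carrier := H\<rparr>) \<and>
      (field_aut_group L ?k)\<lparr>carrier := H\<rparr> \<cong> integer_mod_group n"
    using cyclic iso by (intro exI[of _ ?H]) (simp only: restrict simp_thms)
  moreover have "cyclic_galois_extension L ?K"
    using galois cyclic by (simp only: cyclic_galois_extension_def simp_thms)
  ultimately show ?thesis by blast
qed

end
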